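(* In the coordinates $x=F(\{1,2\})$, $y=F(\{1,3\})$, $z=F(\{2,3\})$, $t=F(\{1,2,3\})$, the GPT profile region $\mathfrak G_3\subset\mathbb R^4$ (points $(x,y,z,t)$) has the following irredundant facet description: \begin{align*} & x\ge0,\quad y\ge0,\quad z\ge0,\\ & t\ge x+y,\quad t\ge x+z,\quad t\ge y+z,\\ & t\le1+x,\quad t\le1+y,\quad t\le1+z. \end{align*} That is, $\mathfrak G_3$ is exactly the set of solutions of these nine inequalities, and each of them defines a facet. Its vertices are exactly $$(0,0,0,0),\ (1,0,0,1),\ (0,1,0,1),\ (0,0,1,1),\ (1,1,1,2),\ (0,0,0,1).$$
   Context: A finite-dimensional GPT state space is a nonempty compact convex subset $K$ of some $\mathbb R^d$, $d\ge1$. A (finite-outcome) measurement on $K$ is a finite family $(e_x)_{x\in X}$ of nonnegative affine functions on $K$ with $\sum_{x}e_x=1$; every such family is allowed. For a list of (not necessarily distinct) states $s_1,s_2,s_3\in K$ and nonempty $H\subseteq\{1,2,3\}$, $D(H)=\max\sum_{i\in H}e_i(s_i)$, the maximum over all measurements $(e_i)_{i\in H}$ indexed by $H$, and $F(H)=|H|-D(H)$. $F$ is the error profile of the list. The region $\mathfrak G_3$ is the set of all vectors $(F(\{1,2\}),F(\{1,3\}),F(\{2,3\}),F(\{1,2,3\}))$ arising from lists of three states in all finite-dimensional GPT state spaces. *)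

theory Defs
  imports "HOL-Analysis.Analysis"
begin

(* R^d is the library's Euclidean_space d, i.e. the sequences nat => real vanishing from index d on,
   so that the dimension d can be quantified over inside the definition of the region below. *)

definition convex_comb :: "real \<Rightarrow> (nat \<Rightarrow> real) \<Rightarrow> (nat \<Rightarrow> real) \<Rightarrow> nat \<Rightarrow> real" where
  "convex_comb u p q = (\<lambda>i. (1 - u) * p i + u * q i)"

(* Convexity is spelled out because nat => real is not an instance of real_vector. *)
definition gpt_state_space :: "nat \<Rightarrow> (nat \<Rightarrow> real) set \<Rightarrow> bool" where
  "gpt_state_space d K \<longleftrightarrow>
     K \<noteq> {} \<and> compactin (Euclidean_space d) K \<and>
     (\<forall>p\<in>K. \<forall>q\<in>K. \<forall>u\<in>{0..1}. convex_comb u p q \<in> K)"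

definition affine_fun_on :: "(nat \<Rightarrow> real) set \<Rightarrow> ((nat \<Rightarrow> real) \<Rightarrow> real) \<Rightarrow> bool" where
  "affine_fun_on K f \<longleftrightarrow>
     (\<forall>p\<in>K. \<forall>q\<in>K. \<forall>u\<in>{0..1}. f (convex_comb u p q) = (1 - u) * f p + u * f q)"

definition gpt_measurement ::
    "(nat \<Rightarrow> real) set \<Rightarrow> 'x set \<Rightarrow> ('x \<Rightarrow> (nat \<Rightarrow> real) \<Rightarrow> real) \<Rightarrow> bool" where
  "gpt_measurement K X e \<longleftrightarrow>
     finite X \<and>
     (\<forall>x\<in>X. affine_fun_on K (e x) \<and> (\<forall>p\<in>K. 0 \<le> e x p)) \<and>
     (\<forall>p\<in>K. (\<Sum>x\<in>X. e x p) = 1)"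

definition gpt_D :: "(nat \<Rightarrow> real) set \<Rightarrow> (nat \<Rightarrow> nat \<Rightarrow> real) \<Rightarrow> nat set \<Rightarrow> real" where
  "gpt_D K s H = (GREATEST m. \<exists>e. gpt_measurement K H e \<and> m = (\<Sum>i\<in>H. e i (s i)))"

definition error_profile :: "(nat \<Rightarrow> real) set \<Rightarrow> (nat \<Rightarrow> nat \<Rightarrow> real) \<Rightarrow> nat set \<Rightarrow> real" where
  "error_profile K s H = real (card H) - gpt_D K s H"

definition gpt_profile_region3 :: "(real \<times> real \<times> real \<times> real) set" where
  "gpt_profile_region3 =
     {(error_profile K s {1,2}, error_profile K s {1,3},
       error_profile K s {2,3}, error_profile K s {1,2,3}) | d K s.
      1 \<le> d \<and> gpt_state_space d K \<and> (\<forall>i\<in>{1,2,3}. s i \<in> K)}"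

end

theory Submission
  imports Defs
begin

text \<open>
  Maxima exist because the measurements form a compact set in the product topology. For the
  inequalities \<open>t \<ge> x + y\<close> and its permutations, coarse-grain an optimal measurement \<open>(e\<^sub>1, e\<^sub>2, e\<^sub>3)\<close> to
  the two-outcome measurements \<open>(1 - e\<^sub>2, e\<^sub>2)\<close> and \<open>(1 - e\<^sub>3, e\<^sub>3)\<close>; the others are immediate.
  Conversely, one fixed state space suffices for all points: in a direct sum of a classical system
  and a square, choose the states with mass \<open>\<alpha>\<close>, \<open>\<beta>\<close>, \<open>\<gamma>\<close>, \<open>\<delta>\<close> on classical points shared by the
  pairs 12, 13, 23 and by all three states, and with mass \<open>\<omega>\<close> on three different vertices of the
  square. The profile is then \<open>(\<alpha> + \<delta>, \<beta> + \<delta>, \<gamma> + \<delta>, \<alpha> + \<beta> + \<gamma> + 2\<delta> + \<omega>)\<close>.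
\<close>

section \<open>Existence of optimal measurements\<close>

lemma gpt_state_space_convex_comb:
  "gpt_state_space d K \<Longrightarrow> p \<in> K \<Longrightarrow> q \<in> K \<Longrightarrow> u \<in> {0..1} \<Longrightarrow> convex_comb u p q \<in> K"
  by (auto simp: gpt_state_space_def)

lemma gpt_measurement_le_1:
  assumes "gpt_measurement K H e" "i \<in> H" "p \<in> K"
  shows "e i p \<le> 1"
  using assms member_le_sum[of i H "\<lambda>i. e i p"] by (auto simp: gpt_measurement_def)

text \<open>The \<open>GREATEST\<close> in \<open>gpt_D\<close> is meaningful only if the maximum is
  attained. Viewed as functions on pairs (outcome, state) with values in [0,1], measurements lie in
  a Tychonoff cube. Each defining condition involves finitely many coordinates and is therefore
  closed, and the objective is a finite sum of coordinates, hence continuous.\<close>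

lemma gpt_D_attained:
  assumes K: "gpt_state_space d K" and H: "finite H" "H \<noteq> {}" and s: "\<And>i. i \<in> H \<Longrightarrow> s i \<in> K"
  obtains e where "gpt_measurement K H e" "gpt_D K s H = (\<Sum>i\<in>H. e i (s i))"
    "\<And>e'. gpt_measurement K H e' \<Longrightarrow> (\<Sum>i\<in>H. e' i (s i)) \<le> gpt_D K s H"
proof -
  define M where "M = (UNIV \<rightarrow>\<^sub>E {0..1}) \<inter> {g. gpt_measurement K H (\<lambda>i p. g (i, p) :: real)}"
  have "compact (UNIV \<rightarrow>\<^sub>E {0..1} :: (nat \<times> (nat \<Rightarrow> real) \<Rightarrow> real) set)"
    using compactin_PiE[of "\<lambda>_. euclidean :: real topology" "UNIV :: (nat \<times> (nat \<Rightarrow> real)) set" "\<lambda>_. {0..1}"]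
    by (simp add: euclidean_product_topology)
  moreover have "closed {g. gpt_measurement K H (\<lambda>i p. g (i, p) :: real)}"
    unfolding gpt_measurement_def affine_fun_on_def Ball_def using H(1)
    by (intro closed_Collect_conj closed_Collect_all closed_Collect_imp closed_Collect_eq closed_Collect_le
        continuous_intros continuous_on_product_coordinates open_Collect_const) auto
  ultimately have "compact M"
    unfolding M_def by (rule compact_Int_closed)
  \<comment> \<open>A measurement is unconstrained outside \<open>H\<close> and \<open>K\<close>, so
    it is set to 0 there to land in the cube; the objective only evaluates at outcomes in
    \<open>H\<close> and states in \<open>K\<close>, so it is unchanged.\<close>
  define restr where "restr e = (\<lambda>(i, p). if i \<in> H \<and> p \<in> K then e i p else 0)"
    for e :: "nat \<Rightarrow> (nat \<Rightarrow> real) \<Rightarrow> real"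
  have restr: "restr e \<in> M" if e: "gpt_measurement K H e" for e
    using gpt_measurement_le_1[OF e] e gpt_state_space_convex_comb[OF K]
    unfolding M_def restr_def gpt_measurement_def affine_fun_on_def by auto
  have restr_sum: "(\<Sum>i\<in>H. restr e (i, s i)) = (\<Sum>i\<in>H. e i (s i))" for e
    using s by (intro sum.cong) (auto simp: restr_def)
  \<comment> \<open>Uniform guessing is a measurement, which makes \<open>M\<close>
    nonempty.\<close>
  have "gpt_measurement K H (\<lambda>_ _. 1 / card H)"
    using H by (auto simp: gpt_measurement_def affine_fun_on_def add_divide_distrib[symmetric])
  then have "M \<noteq> {}"
    using restr by blast
  have "continuous_on M (\<lambda>g. \<Sum>i\<in>H. g (i, s i))"
    by (intro continuous_intros continuous_on_subset[OF continuous_on_product_coordinates]) auto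
  from continuous_attains_sup[OF \<open>compact M\<close> \<open>M \<noteq> {}\<close> this]
  obtain g where g: "g \<in> M" "\<forall>h\<in>M. (\<Sum>i\<in>H. h (i, s i)) \<le> (\<Sum>i\<in>H. g (i, s i))"
    by blast
  define e where "e = (\<lambda>i p. g (i, p))"
  have e: "gpt_measurement K H e"
    using g(1) by (simp add: M_def e_def)
  have max: "(\<Sum>i\<in>H. e' i (s i)) \<le> (\<Sum>i\<in>H. e i (s i))" if "gpt_measurement K H e'" for e'
    using bspec[OF g(2) restr[OF that]] by (simp add: restr_sum e_def)
  have "gpt_D K s H = (\<Sum>i\<in>H. e i (s i))"
    unfolding gpt_D_def using e max by (intro Greatest_equality) auto
  then show thesis
    using that[OF e] max by simp
qed

lemma gpt_D_ge:
  assumes "gpt_state_space d K" "finite H" "H \<noteq> {}" "\<And>i. i \<in> H \<Longrightarrow> s i \<in> K"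
    and e: "gpt_measurement K H e"
  shows "(\<Sum>i\<in>H. e i (s i)) \<le> gpt_D K s H"
  by (rule gpt_D_attained[OF assms(1-4)]) (use e in blast)+

section \<open>Necessity of the nine inequalities\<close>

definition profile_polytope :: "(real \<times> real \<times> real \<times> real) set" where
  "profile_polytope = {(x, y, z, t). 0 \<le> x \<and> 0 \<le> y \<and> 0 \<le> z \<and>
     x + y \<le> t \<and> x + z \<le> t \<and> y + z \<le> t \<and> t \<le> 1 + x \<and> t \<le> 1 + y \<and> t \<le> 1 + z}"

lemma error_profile_nonneg:
  assumes K: "gpt_state_space d K" and H: "finite H" "H \<noteq> {}" and s: "\<And>i. i \<in> H \<Longrightarrow> s i \<in> K"
  shows "0 \<le> error_profile K s H"
proof -
  obtain e where e: "gpt_measurement K H e" "gpt_D K s H = (\<Sum>i\<in>H. e i (s i))"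
    by (rule gpt_D_attained[OF assms])
  have "(\<Sum>i\<in>H. e i (s i)) \<le> (\<Sum>i\<in>H. 1)"
    using gpt_measurement_le_1[OF e(1)] s by (intro sum_mono) auto
  then show ?thesis
    by (simp add: error_profile_def e(2))
qed

text \<open>Giving the new outcome the zero effect keeps an optimal measurement for \<open>H\<close>
  valid, so the success sum does not drop while the cardinality grows by one.\<close>

lemma error_profile_insert_le:
  assumes K: "gpt_state_space d K" and H: "finite H" "H \<noteq> {}" and s: "\<And>i. i \<in> insert j H \<Longrightarrow> s i \<in> K"
    and j: "j \<notin> H"
  shows "error_profile K s (insert j H) \<le> 1 + error_profile K s H"
proof -
  obtain e where e: "gpt_measurement K H e" "gpt_D K s H = (\<Sum>i\<in>H. e i (s i))"
    by (rule gpt_D_attained[OF K H, of s]) (use s in blast)+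
  define e' where "e' = (\<lambda>i p. if i \<in> H then e i p else 0)"
  have [simp]: "(\<Sum>i\<in>H. e' i (q i)) = (\<Sum>i\<in>H. e i (q i))" "e' j q' = 0" for q q'
    using j by (auto simp: e'_def)
  have "gpt_measurement K (insert j H) e'"
    using e(1) j H(1) by (auto simp: gpt_measurement_def affine_fun_on_def e'_def)
  then have "(\<Sum>i\<in>insert j H. e' i (s i)) \<le> gpt_D K s (insert j H)"
    by (intro gpt_D_ge[OF K]) (use H s in auto)
  then show ?thesis
    using j H by (simp add: error_profile_def e(2))
qed

text \<open>The effect \<open>f\<close> announces \<open>j\<close> and its complement announces
  \<open>i\<close>; this is the form in which coarse-grained measurements enter the next
  lemma.\<close>

lemma gpt_D_pair_ge:
  assumes K: "gpt_state_space d K" and ij: "i \<noteq> j" and s: "s i \<in> K" "s j \<in> K"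
    and f: "affine_fun_on K f" "\<And>p. p \<in> K \<Longrightarrow> 0 \<le> f p" "\<And>p. p \<in> K \<Longrightarrow> f p \<le> 1"
  shows "1 - f (s i) + f (s j) \<le> gpt_D K s {i, j}"
proof -
  define e where "e = (\<lambda>k p. if k = j then f p else 1 - f p)"
  have "gpt_measurement K {i, j} e"
    using ij f by (auto simp: gpt_measurement_def affine_fun_on_def e_def algebra_simps)
  then have "(\<Sum>k\<in>{i, j}. e k (s k)) \<le> gpt_D K s {i, j}"
    by (intro gpt_D_ge[OF K]) (use s in auto)
  then show ?thesis
    using ij by (simp add: e_def)
qed

text \<open>For an optimal triple measurement, test \<open>e j\<close> against its complement and
  \<open>e k\<close> against its complement. By normalisation at \<open>s i\<close>, the two success
  sums add up to 1 plus the triple optimum, and subtracting from 4 gives the claim.\<close>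

lemma error_profile_triple_ge:
  assumes K: "gpt_state_space d K" and ijk: "i \<noteq> j" "i \<noteq> k" "j \<noteq> k"
    and s: "s i \<in> K" "s j \<in> K" "s k \<in> K"
  shows "error_profile K s {i, j} + error_profile K s {i, k} \<le> error_profile K s {i, j, k}"
proof -
  obtain e where e: "gpt_measurement K {i, j, k} e" "gpt_D K s {i, j, k} = (\<Sum>l\<in>{i, j, k}. e l (s l))"
    by (rule gpt_D_attained[OF K, of "{i, j, k}" s]) (use s in blast)+
  have "e i (s i) + e j (s i) + e k (s i) = 1"
    using e(1) ijk s by (auto simp: gpt_measurement_def)
  moreover have "1 - e l (s i) + e l (s l) \<le> gpt_D K s {i, l}" if "l = j \<or> l = k" for l
  proof (rule gpt_D_pair_ge[OF K])
    show "affine_fun_on K (e l)" "\<And>p. p \<in> K \<Longrightarrow> 0 \<le> e l p"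
      using e(1) that by (auto simp: gpt_measurement_def)
    show "\<And>p. p \<in> K \<Longrightarrow> e l p \<le> 1"
      using gpt_measurement_le_1[OF e(1)] that by blast
  qed (use that ijk s in auto)
  from this[of j] this[of k] have "1 - e j (s i) + e j (s j) \<le> gpt_D K s {i, j}"
    "1 - e k (s i) + e k (s k) \<le> gpt_D K s {i, k}" by auto
  ultimately show ?thesis
    using ijk e(2) by (simp add: error_profile_def)
qed

lemma gpt_profile_region3_subset: "gpt_profile_region3 \<subseteq> profile_polytope"
proof
  fix p assume "p \<in> gpt_profile_region3"
  then obtain d K s where K: "gpt_state_space d K" and s: "\<forall>i\<in>{1, 2, 3}. s i \<in> K"
    and p: "p = (error_profile K s {1,2}, error_profile K s {1,3},
       error_profile K s {2,3}, error_profile K s {1,2,3})"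
    unfolding gpt_profile_region3_def mem_Collect_eq by (elim exE conjE)
  have s': "s 1 \<in> K" "s 2 \<in> K" "s 3 \<in> K"
    using s by simp_all
  have perm: "{2, 1, 3} = {1, 2, 3 :: nat}" "{3, 1, 2} = {1, 2, 3 :: nat}"
    "{3, 1} = {1, 3 :: nat}" "{3, 2} = {2, 3 :: nat}" "{2, 1} = {1, 2 :: nat}"
    by auto
  have insert_le: "error_profile K s {1, 2, 3} \<le> 1 + error_profile K s H"
    if "{1, 2, 3} = insert j H" "finite H" "H \<noteq> {}" "j \<notin> H" for j H
    unfolding that(1) using that s by (intro error_profile_insert_le[OF K]) auto
  have "0 \<le> error_profile K s {1, 2}" "0 \<le> error_profile K s {1, 3}" "0 \<le> error_profile K s {2, 3}"
    using s by (auto intro!: error_profile_nonneg[OF K])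
  moreover have "error_profile K s {1, 2, 3} \<le> 1 + error_profile K s {1, 2}"
    "error_profile K s {1, 2, 3} \<le> 1 + error_profile K s {1, 3}"
    "error_profile K s {1, 2, 3} \<le> 1 + error_profile K s {2, 3}"
    using insert_le[of 3 "{1, 2}"] insert_le[of 2 "{1, 3}"] insert_le[of 1 "{2, 3}"]
    unfolding perm by simp_all
  moreover have "error_profile K s {1, 2} + error_profile K s {1, 3} \<le> error_profile K s {1, 2, 3}"
    "error_profile K s {1, 2} + error_profile K s {2, 3} \<le> error_profile K s {1, 2, 3}"
    "error_profile K s {1, 3} + error_profile K s {2, 3} \<le> error_profile K s {1, 2, 3}"
    using error_profile_triple_ge[OF K _ _ _ s'(1,2,3)] error_profile_triple_ge[OF K _ _ _ s'(2,1,3)]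
      error_profile_triple_ge[OF K _ _ _ s'(3,1,2)]
    unfolding perm by simp_all
  ultimately show "p \<in> profile_polytope"
    by (simp add: p profile_polytope_def)
qed

section \<open>Finite mixtures and the model state space\<close>

lemma affine_fun_on_sum:
  assumes conv: "\<And>p q u. p \<in> K \<Longrightarrow> q \<in> K \<Longrightarrow> u \<in> {0..1} \<Longrightarrow> convex_comb u p q \<in> K"
    and "finite J" "(\<Sum>j\<in>J. w j) = 1" "\<And>j. j \<in> J \<Longrightarrow> 0 \<le> w j" "\<And>j. j \<in> J \<Longrightarrow> p j \<in> K"
  shows "(\<lambda>i. \<Sum>j\<in>J. w j * p j i) \<in> K \<and>
    (\<forall>f. affine_fun_on K f \<longrightarrow> f (\<lambda>i. \<Sum>j\<in>J. w j * p j i) = (\<Sum>j\<in>J. w j * f (p j)))"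
  using assms(2-)
proof (induction J arbitrary: w rule: finite_induct)
  case empty
  then show ?case by simp
next
  case (insert k J)
  \<comment> \<open>Affinity is only given for two points, so point \<open>k\<close> is split off
    and the rest, of total weight \<open>v\<close>, is renormalised to a state \<open>q\<close>. The
    case \<open>w k = 1\<close> is separate because there \<open>v\<close> is zero.\<close>
  show ?case
  proof (cases "w k = 1")
    case True
    then have "\<forall>j\<in>J. w j = 0"
      using insert.prems insert.hyps sum_nonneg_eq_0_iff[of J w] by auto
    then show ?thesis
      using True insert by simp
  next
    case False
    define v where "v = 1 - w k"
    have wk': "w k = 1 - v"
      by (simp add: v_def)
    have sum_J: "(\<Sum>j\<in>J. w j) = v" and wk: "0 \<le> w k"
      using insert by (auto simp: v_def)
    moreover have "0 \<le> (\<Sum>j\<in>J. w j)"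
      using insert.prems by (intro sum_nonneg) auto
    ultimately have v: "0 < v" "v \<in> {0..1}"
      using False by (auto simp: v_def)
    define q where "q = (\<lambda>i. \<Sum>j\<in>J. w j / v * p j i)"
    have q: "q \<in> K" "\<And>f. affine_fun_on K f \<Longrightarrow> f q = (\<Sum>j\<in>J. w j / v * f (p j))"
      using insert.IH[of "\<lambda>j. w j / v"] insert.prems v sum_J
      by (auto simp: q_def sum_divide_distrib[symmetric])
    have pull: "(\<Sum>j\<in>J. w j / v * g j) = (\<Sum>j\<in>J. w j * g j) / v" for g
      by (simp add: sum_divide_distrib)
    have comb: "(\<lambda>i. \<Sum>j\<in>insert k J. w j * p j i) = convex_comb v (p k) q"
      using insert.hyps v(1) wk' unfolding convex_comb_def q_def pull by simp
    have "f (convex_comb v (p k) q) = (\<Sum>j\<in>insert k J. w j * f (p j))" if f: "affine_fun_on K f" for f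
    proof -
      have "f (convex_comb v (p k) q) = (1 - v) * f (p k) + v * f q"
        using f insert.prems q(1) v(2) unfolding affine_fun_on_def by blast
      then show ?thesis
        using insert.hyps v(1) unfolding q(2)[OF f] pull by (simp add: wk')
    qed
    then show ?thesis
      unfolding comb using conv insert.prems q(1) v(2) by simp
  qed
qed

text \<open>
  The state space realising a given point is the direct sum of a classical system with seven pure
  states (coordinates 0 to 6) and a square, whose four vertices
  \<open>q\<^sub>1, q\<^sub>2, q\<^sub>3, q\<^sub>4\<close> are the indicators of \<open>{7, 9}\<close>, \<open>{8, 9}\<close>, \<open>{7, 10}\<close>, \<open>{8, 10}\<close>.
\<close>
definition model_space :: "(nat \<Rightarrow> real) set" where
  "model_space = {v. (\<forall>i. 0 \<le> v i) \<and> (\<forall>i\<ge>11. v i = 0) \<and>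
     v 0 + v 1 + v 2 + v 3 + v 4 + v 5 + v 6 + v 7 + v 8 = 1 \<and> v 7 + v 8 = v 9 + v 10}"

text \<open>This places the closed set \<open>model_space\<close> inside a cube that is compact in
  the product topology.\<close>

lemma model_space_le_1:
  assumes "v \<in> model_space"
  shows "v i \<le> 1"
proof (cases "i \<ge> 11")
  case True
  then show ?thesis
    using assms by (simp add: model_space_def)
next
  case False
  then have "i \<in> {0, 1, 2, 3, 4, 5, 6, 7, 8, 9, 10}"
    unfolding insert_iff empty_iff by presburger
  moreover have "\<forall>j. 0 \<le> v j" "v 0 + v 1 + v 2 + v 3 + v 4 + v 5 + v 6 + v 7 + v 8 = 1"
    "v 7 + v 8 = v 9 + v 10"
    using assms by (auto simp: model_space_def)
  from this(2,3) this(1)[rule_format, of 0] this(1)[rule_format, of 1] this(1)[rule_format, of 2]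
    this(1)[rule_format, of 3] this(1)[rule_format, of 4] this(1)[rule_format, of 5]
    this(1)[rule_format, of 6] this(1)[rule_format, of 7] this(1)[rule_format, of 8]
    this(1)[rule_format, of 9] this(1)[rule_format, of 10]
  have "v 0 \<le> 1" "v 1 \<le> 1" "v 2 \<le> 1" "v 3 \<le> 1" "v 4 \<le> 1" "v 5 \<le> 1" "v 6 \<le> 1" "v 7 \<le> 1"
    "v 8 \<le> 1" "v 9 \<le> 1" "v 10 \<le> 1"
    by linarith+
  ultimately show ?thesis
    by auto
qed

lemma convex_comb_model_space:
  assumes "p \<in> model_space" "q \<in> model_space" "u \<in> {0..1}"
  shows "convex_comb u p q \<in> model_space"
proof -
  have "convex_comb u p q 0 + convex_comb u p q 1 + convex_comb u p q 2 + convex_comb u p q 3 +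
      convex_comb u p q 4 + convex_comb u p q 5 + convex_comb u p q 6 + convex_comb u p q 7 +
      convex_comb u p q 8 =
      (1 - u) * (p 0 + p 1 + p 2 + p 3 + p 4 + p 5 + p 6 + p 7 + p 8) +
      u * (q 0 + q 1 + q 2 + q 3 + q 4 + q 5 + q 6 + q 7 + q 8)"
    unfolding convex_comb_def by algebra
  also have "\<dots> = 1"
    using assms by (simp add: model_space_def)
  finally have 1: "convex_comb u p q 0 + convex_comb u p q 1 + convex_comb u p q 2 + convex_comb u p q 3 +
      convex_comb u p q 4 + convex_comb u p q 5 + convex_comb u p q 6 + convex_comb u p q 7 +
      convex_comb u p q 8 = 1" .
  have "convex_comb u p q 7 + convex_comb u p q 8 = (1 - u) * (p 7 + p 8) + u * (q 7 + q 8)"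
    unfolding convex_comb_def by algebra
  also have "\<dots> = (1 - u) * (p 9 + p 10) + u * (q 9 + q 10)"
    using assms by (simp add: model_space_def)
  also have "\<dots> = convex_comb u p q 9 + convex_comb u p q 10"
    unfolding convex_comb_def by algebra
  finally have 2: "convex_comb u p q 7 + convex_comb u p q 8 = convex_comb u p q 9 + convex_comb u p q 10" .
  have "0 \<le> convex_comb u p q i" "i \<ge> 11 \<Longrightarrow> convex_comb u p q i = 0" for i
    using assms by (auto simp: model_space_def convex_comb_def)
  with 1 2 show ?thesis
    unfolding model_space_def by blast
qed

lemma gpt_state_space_model_space: "gpt_state_space 11 model_space"
proof -
  have "compact (UNIV \<rightarrow>\<^sub>E {0..1} :: (nat \<Rightarrow> real) set)"
    using compactin_PiE[of "\<lambda>_. euclidean :: real topology" "UNIV :: nat set" "\<lambda>_. {0..1}"]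
    by (simp add: euclidean_product_topology)
  moreover have "closed model_space"
    unfolding model_space_def
    by (intro closed_Collect_conj closed_Collect_all closed_Collect_imp closed_Collect_eq closed_Collect_le
        continuous_intros continuous_on_product_coordinates open_Collect_const)
  ultimately have "compact ((UNIV \<rightarrow>\<^sub>E {0..1}) \<inter> model_space)"
    by (rule compact_Int_closed)
  also have "(UNIV \<rightarrow>\<^sub>E {0..1}) \<inter> model_space = model_space"
    using model_space_le_1 by (auto simp: model_space_def)
  finally have "compactin (Euclidean_space 11) model_space"
    by (auto simp: Euclidean_space_def compactin_subtopology euclidean_product_topology model_space_def)
  moreover have "indicator {0} \<in> model_space"
    by (auto simp: model_space_def)
  ultimately show ?thesis
    unfolding gpt_state_space_def using convex_comb_model_space by blast
qed

text \<open>Each optimum below is certified by an explicit measurement and a matching upper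
  bound.\<close>

lemma gpt_D_eqI:
  assumes "gpt_measurement K H e" "(\<Sum>i\<in>H. e i (s i)) = m"
    and "\<And>e. gpt_measurement K H e \<Longrightarrow> (\<Sum>i\<in>H. e i (s i)) \<le> m"
  shows "gpt_D K s H = m"
  unfolding gpt_D_def using assms by (intro Greatest_equality) auto

text \<open>Five slots suffice: each state used below mixes one private point, two points shared by
  pairs, one point shared by all three states and one vertex of the square.\<close>

definition model_state :: "nat set list \<Rightarrow> real list \<Rightarrow> nat \<Rightarrow> real" where
  "model_state As ws = (\<lambda>i. \<Sum>j<5. ws ! j * indicator (As ! j) i)"

definition model_vertices :: "nat set set" where
  "model_vertices = {{0}, {1}, {2}, {3}, {4}, {5}, {6}, {7, 9}, {8, 9}, {7, 10}, {8, 10}}"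

lemma indicator_in_model_space: "A \<in> model_vertices \<Longrightarrow> indicator A \<in> model_space"
  by (auto simp: model_vertices_def model_space_def)

lemma lessThan_5: "{..<5} = {0, 1, 2, 3, 4 :: nat}"
  by auto

lemma model_state:
  assumes "A1 \<in> model_vertices" "A2 \<in> model_vertices" "A3 \<in> model_vertices"
    "A4 \<in> model_vertices" "A5 \<in> model_vertices"
    and "0 \<le> w1" "0 \<le> w2" "0 \<le> w3" "0 \<le> w4" "0 \<le> w5" "w1 + w2 + w3 + w4 + w5 = 1"
  shows "model_state [A1, A2, A3, A4, A5] [w1, w2, w3, w4, w5] \<in> model_space"
    and "affine_fun_on model_space f \<Longrightarrow> f (model_state [A1, A2, A3, A4, A5] [w1, w2, w3, w4, w5]) =
      w1 * f (indicator A1) + w2 * f (indicator A2) + w3 * f (indicator A3) + w4 * f (indicator A4) +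
      w5 * f (indicator A5)"
proof -
  let ?As = "[A1, A2, A3, A4, A5]" and ?ws = "[w1, w2, w3, w4, w5]"
  have *: "model_state ?As ?ws \<in> model_space \<and> (\<forall>f. affine_fun_on model_space f \<longrightarrow>
      f (model_state ?As ?ws) = (\<Sum>j<5. ?ws ! j * f (indicator (?As ! j))))"
    unfolding model_state_def
  proof (rule affine_fun_on_sum[OF convex_comb_model_space])
    show "(\<Sum>j<5. ?ws ! j) = 1"
      using assms by (simp add: lessThan_5)
    show "0 \<le> ?ws ! j" "indicator (?As ! j) \<in> model_space" if "j \<in> {..<5}" for j
      using that assms indicator_in_model_space unfolding lessThan_5 by auto
  qed auto
  show "model_state ?As ?ws \<in> model_space"
    using * by blast
  show "f (model_state ?As ?ws) = w1 * f (indicator A1) + w2 * f (indicator A2) +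
      w3 * f (indicator A3) + w4 * f (indicator A4) + w5 * f (indicator A5)"
    if "affine_fun_on model_space f"
    using * that by (simp add: lessThan_5 add.assoc)
qed

text \<open>The two diagonals of the square have the same midpoint.\<close>

lemma square_affine_relation:
  assumes "affine_fun_on model_space f"
  shows "f (indicator {7, 9}) + f (indicator {8, 10}) = f (indicator {8, 9}) + f (indicator {7, 10})"
proof -
  have "convex_comb (1/2) (indicator {7, 9}) (indicator {8, 10}) =
      convex_comb (1/2) (indicator {8, 9}) (indicator {7, 10})"
    by (auto simp: convex_comb_def indicator_def)
  moreover have half: "f (convex_comb (1/2) (indicator A) (indicator B)) = (f (indicator A) + f (indicator B)) / 2"
    if "A \<in> model_vertices" "B \<in> model_vertices" for A B
    using assms that indicator_in_model_space by (simp add: affine_fun_on_def)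
  from half[of "{7, 9}" "{8, 10}"] half[of "{8, 9}" "{7, 10}"]
  have "f (convex_comb (1/2) (indicator {7, 9}) (indicator {8, 10})) =
      (f (indicator {7, 9}) + f (indicator {8, 10})) / 2"
    "f (convex_comb (1/2) (indicator {8, 9}) (indicator {7, 10})) =
      (f (indicator {8, 9}) + f (indicator {7, 10})) / 2"
    by (simp_all add: model_vertices_def)
  ultimately show ?thesis
    by simp
qed

text \<open>A pure component \<open>p\<close> of weight \<open>w\<close>, common to all states in
  \<open>G\<close>, contributes at most \<open>w\<close> to the success sum, however many states
  share it.\<close>

lemma gpt_measurement_scaled_le:
  assumes "gpt_measurement K H e" "G \<subseteq> H" "0 \<le> w" "p \<in> K"
  shows "(\<Sum>i\<in>G. w * e i p) \<le> w"
proof -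
  have "(\<Sum>i\<in>G. e i p) \<le> (\<Sum>i\<in>H. e i p)"
    using assms by (intro sum_mono2) (auto simp: gpt_measurement_def)
  also have "\<dots> = 1"
    using assms by (simp add: gpt_measurement_def)
  finally show ?thesis
    using assms(3) by (simp add: mult_left_le sum_distrib_left[symmetric])
qed

section \<open>Optimal discrimination of the model states\<close>

text \<open>\<open>m1\<close>, \<open>m2\<close>, \<open>m3\<close> are the masses left on the private classical points 0, 1, 2.\<close>
locale profile_weights =
  fixes \<alpha> \<beta> \<gamma> \<delta> \<omega> m1 m2 m3 :: real
  assumes nonneg: "0 \<le> \<alpha>" "0 \<le> \<beta>" "0 \<le> \<gamma>" "0 \<le> \<delta>" "0 \<le> \<omega>" "0 \<le> m1" "0 \<le> m2" "0 \<le> m3"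
    and total: "m1 + \<alpha> + \<beta> + \<delta> + \<omega> = 1" "m2 + \<alpha> + \<gamma> + \<delta> + \<omega> = 1" "m3 + \<beta> + \<gamma> + \<delta> + \<omega> = 1"
begin

text \<open>Points 0, 1, 2 are private, points 3, 4, 5 belong to the pairs 12, 13, 23, point 6 to
  all three. The last branch also serves indices other than 3, so that every \<open>st i\<close> is
  a state.\<close>

definition st :: "nat \<Rightarrow> nat \<Rightarrow> real" where
  "st i = (if i = 1 then model_state [{0}, {3}, {4}, {6}, {7, 9}] [m1, \<alpha>, \<beta>, \<delta>, \<omega>]
     else if i = 2 then model_state [{1}, {3}, {5}, {6}, {8, 9}] [m2, \<alpha>, \<gamma>, \<delta>, \<omega>]
     else model_state [{2}, {4}, {5}, {6}, {7, 10}] [m3, \<beta>, \<gamma>, \<delta>, \<omega>])"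

lemma st_in: "st i \<in> model_space"
  unfolding st_def using nonneg total by (auto intro!: model_state simp: model_vertices_def)

lemma affine_st:
  assumes "affine_fun_on model_space f"
  shows "f (st 1) = m1 * f (indicator {0}) + \<alpha> * f (indicator {3}) +
      \<beta> * f (indicator {4}) + \<delta> * f (indicator {6}) + \<omega> * f (indicator {7, 9})"
    and "f (st 2) = m2 * f (indicator {1}) + \<alpha> * f (indicator {3}) +
      \<gamma> * f (indicator {5}) + \<delta> * f (indicator {6}) + \<omega> * f (indicator {8, 9})"
    and "f (st 3) = m3 * f (indicator {2}) + \<beta> * f (indicator {4}) +
      \<gamma> * f (indicator {5}) + \<delta> * f (indicator {6}) + \<omega> * f (indicator {7, 10})"
  unfolding st_def using nonneg total assms by (simp_all add: model_state model_vertices_def)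

text \<open>Coordinate projections are affine, so \<open>affine_st\<close> applies to them.
  \<open>Suc 0\<close> is the simp normal form of the index 1.\<close>

lemma st_coords:
  "st (Suc 0) j = m1 * indicator {0} j + \<alpha> * indicator {3} j +
      \<beta> * indicator {4} j + \<delta> * indicator {6} j + \<omega> * indicator {7, 9} j"
  "st 2 j = m2 * indicator {1} j + \<alpha> * indicator {3} j +
      \<gamma> * indicator {5} j + \<delta> * indicator {6} j + \<omega> * indicator {8, 9} j"
  "st 3 j = m3 * indicator {2} j + \<beta> * indicator {4} j +
      \<gamma> * indicator {5} j + \<delta> * indicator {6} j + \<omega> * indicator {7, 10} j"
  using affine_st[of "\<lambda>v. v j"] by (simp_all add: affine_fun_on_def convex_comb_def)

lemma gpt_D_st_12: "gpt_D model_space st {1, 2} = 2 - (\<alpha> + \<delta>)"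
proof (rule gpt_D_eqI)
  \<comment> \<open>A point held by one of the two states announces that state; the shared points 3
    and 6 are given to state 1, which loses \<alpha> + \<delta>. Coordinates 7 and 8 separate the
    two square vertices.\<close>
  let ?e = "\<lambda>i v. if i = (1 :: nat) then v 0 + v 2 + v 3 + v 4 + v 6 + v 7 else v 1 + v 5 + v (8 :: nat) :: real"
  show "gpt_measurement model_space {1, 2} ?e"
    by (auto simp: gpt_measurement_def affine_fun_on_def convex_comb_def model_space_def algebra_simps)
  show "(\<Sum>i\<in>{1, 2}. ?e i (st i)) = 2 - (\<alpha> + \<delta>)"
    using total by (simp add: st_coords)
next
  fix e assume e: "gpt_measurement model_space {1 :: nat, 2} e"
  then have aff: "affine_fun_on model_space (e 1)" "affine_fun_on model_space (e 2)"
    by (auto simp: gpt_measurement_def)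
  have le: "w * e 1 (indicator A) \<le> w" "w * e 2 (indicator A) \<le> w"
    "w * e 1 (indicator A) + w * e 2 (indicator A) \<le> w"
    if "0 \<le> w" "A \<in> model_vertices" for w A
    using that indicator_in_model_space gpt_measurement_scaled_le[OF e, of "{1}" w "indicator A"]
      gpt_measurement_scaled_le[OF e, of "{2}" w "indicator A"]
      gpt_measurement_scaled_le[OF e, of "{1, 2}" w "indicator A"] by auto
  show "(\<Sum>i\<in>{1, 2}. e i (st i)) \<le> 2 - (\<alpha> + \<delta>)"
    using total nonneg le(1)[of m1 "{0}"] le(2)[of m2 "{1}"] le(3)[of \<alpha> "{3}"]
      le(1)[of \<beta> "{4}"] le(2)[of \<gamma> "{5}"] le(3)[of \<delta> "{6}"] le(1)[of \<omega> "{7, 9}"] le(2)[of \<omega> "{8, 9}"]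
    by (simp del: One_nat_def add: affine_st[OF aff(1)] affine_st[OF aff(2)] model_vertices_def)
qed

lemma gpt_D_st_13: "gpt_D model_space st {1, 3} = 2 - (\<beta> + \<delta>)"
proof (rule gpt_D_eqI)
  \<comment> \<open>The square vertices of states 1 and 3 agree in coordinate 7, so the other pair
    of coordinates, 9 and 10, separates them.\<close>
  let ?e = "\<lambda>i v. if i = (1 :: nat) then v 0 + v 1 + v 3 + v 4 + v 6 + v 9 else v 2 + v 5 + v (10 :: nat) :: real"
  show "gpt_measurement model_space {1, 3} ?e"
    by (auto simp: gpt_measurement_def affine_fun_on_def convex_comb_def model_space_def algebra_simps)
  show "(\<Sum>i\<in>{1, 3}. ?e i (st i)) = 2 - (\<beta> + \<delta>)"
    using total by (simp add: st_coords)
next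
  fix e assume e: "gpt_measurement model_space {1 :: nat, 3} e"
  then have aff: "affine_fun_on model_space (e 1)" "affine_fun_on model_space (e 3)"
    by (auto simp: gpt_measurement_def)
  have le: "w * e 1 (indicator A) \<le> w" "w * e 3 (indicator A) \<le> w"
    "w * e 1 (indicator A) + w * e 3 (indicator A) \<le> w"
    if "0 \<le> w" "A \<in> model_vertices" for w A
    using that indicator_in_model_space gpt_measurement_scaled_le[OF e, of "{1}" w "indicator A"]
      gpt_measurement_scaled_le[OF e, of "{3}" w "indicator A"]
      gpt_measurement_scaled_le[OF e, of "{1, 3}" w "indicator A"] by auto
  show "(\<Sum>i\<in>{1, 3}. e i (st i)) \<le> 2 - (\<beta> + \<delta>)"
    using total nonneg le(1)[of m1 "{0}"] le(2)[of m3 "{2}"] le(1)[of \<alpha> "{3}"]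
      le(3)[of \<beta> "{4}"] le(2)[of \<gamma> "{5}"] le(3)[of \<delta> "{6}"] le(1)[of \<omega> "{7, 9}"] le(2)[of \<omega> "{7, 10}"]
    by (simp del: One_nat_def add: affine_st[OF aff(1)] affine_st[OF aff(2)] model_vertices_def)
qed

lemma gpt_D_st_23: "gpt_D model_space st {2, 3} = 2 - (\<gamma> + \<delta>)"
proof (rule gpt_D_eqI)
  let ?e = "\<lambda>i v. if i = (2 :: nat) then v 0 + v 1 + v 3 + v 5 + v 6 + v 8 else v 2 + v 4 + v (7 :: nat) :: real"
  show "gpt_measurement model_space {2, 3} ?e"
    by (auto simp: gpt_measurement_def affine_fun_on_def convex_comb_def model_space_def algebra_simps)
  show "(\<Sum>i\<in>{2, 3}. ?e i (st i)) = 2 - (\<gamma> + \<delta>)"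
    using total by (simp add: st_coords)
next
  fix e assume e: "gpt_measurement model_space {2 :: nat, 3} e"
  then have aff: "affine_fun_on model_space (e 2)" "affine_fun_on model_space (e 3)"
    by (auto simp: gpt_measurement_def)
  have le: "w * e 2 (indicator A) \<le> w" "w * e 3 (indicator A) \<le> w"
    "w * e 2 (indicator A) + w * e 3 (indicator A) \<le> w"
    if "0 \<le> w" "A \<in> model_vertices" for w A
    using that indicator_in_model_space gpt_measurement_scaled_le[OF e, of "{2}" w "indicator A"]
      gpt_measurement_scaled_le[OF e, of "{3}" w "indicator A"]
      gpt_measurement_scaled_le[OF e, of "{2, 3}" w "indicator A"] by auto
  show "(\<Sum>i\<in>{2, 3}. e i (st i)) \<le> 2 - (\<gamma> + \<delta>)"
    using total nonneg le(1)[of m2 "{1}"] le(2)[of m3 "{2}"] le(1)[of \<alpha> "{3}"]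
      le(2)[of \<beta> "{4}"] le(3)[of \<gamma> "{5}"] le(3)[of \<delta> "{6}"] le(1)[of \<omega> "{8, 9}"] le(2)[of \<omega> "{7, 10}"]
    by (simp del: One_nat_def add: affine_st[OF aff(1)] affine_st[OF aff(2)] model_vertices_def)
qed

text \<open>
  On the square, \<open>e\<^sub>1(q\<^sub>1) \<le> e\<^sub>1(q\<^sub>1) + e\<^sub>1(q\<^sub>4) = e\<^sub>1(q\<^sub>2) + e\<^sub>1(q\<^sub>3)\<close>, so the
  three vertices contribute at most \<open>(e\<^sub>1 + e\<^sub>2)(q\<^sub>2) + (e\<^sub>1 + e\<^sub>3)(q\<^sub>3) \<le> 2\<close>, although they are
  pairwise perfectly distinguishable.
\<close>
lemma gpt_D_st_123: "gpt_D model_space st {1, 2, 3} = 3 - (\<alpha> + \<beta> + \<gamma> + 2 * \<delta> + \<omega>)"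
proof (rule gpt_D_eqI)
  \<comment> \<open>On the square, the vertices of states 1 and 2 are told apart perfectly and that
    of state 3 is given up, at a loss of \<omega>.\<close>
  let ?e = "\<lambda>i v. if i = (1 :: nat) then v 0 + v 3 + v 4 + v 6 + v 7
    else if i = 2 then v 1 + v 5 + v 8 else v (2 :: nat) :: real"
  show "gpt_measurement model_space {1, 2, 3} ?e"
    by (auto simp: gpt_measurement_def affine_fun_on_def convex_comb_def model_space_def algebra_simps)
  show "(\<Sum>i\<in>{1, 2, 3}. ?e i (st i)) = 3 - (\<alpha> + \<beta> + \<gamma> + 2 * \<delta> + \<omega>)"
    using total by (simp add: st_coords)
next
  fix e assume e: "gpt_measurement model_space {1 :: nat, 2, 3} e"
  then have aff: "affine_fun_on model_space (e 1)" "affine_fun_on model_space (e 2)"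
    "affine_fun_on model_space (e 3)"
    by (auto simp: gpt_measurement_def)
  have single: "w * e i (indicator A) \<le> w"
    if "i \<in> {1, 2, 3}" "0 \<le> w" "A \<in> model_vertices" for i w A
    using that indicator_in_model_space gpt_measurement_scaled_le[OF e, of "{i}" w "indicator A"] by simp
  have pair: "w * e i (indicator A) + w * e j (indicator A) \<le> w"
    if "{i, j} \<subseteq> {1, 2, 3}" "i \<noteq> j" "0 \<le> w" "A \<in> model_vertices" for i j w A
    using that indicator_in_model_space gpt_measurement_scaled_le[OF e, of "{i, j}" w "indicator A"] by simp
  have triple: "w * e 1 (indicator A) + w * e 2 (indicator A) + w * e 3 (indicator A) \<le> w"
    if "0 \<le> w" "A \<in> model_vertices" for w A
    using that indicator_in_model_space gpt_measurement_scaled_le[OF e, of "{1, 2, 3}" w "indicator A"] by simp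
  have "0 \<le> e 1 (indicator {8, 10})"
    using e indicator_in_model_space[of "{8, 10}"] by (simp add: gpt_measurement_def model_vertices_def)
  then have "e 1 (indicator {7, 9}) \<le> e 1 (indicator {8, 9}) + e 1 (indicator {7, 10})"
    using square_affine_relation[OF aff(1)] by simp
  then have "\<omega> * e 1 (indicator {7, 9}) \<le> \<omega> * e 1 (indicator {8, 9}) + \<omega> * e 1 (indicator {7, 10})"
    using mult_left_mono[OF _ nonneg(5)] by (simp add: distrib_left[symmetric])
  then show "(\<Sum>i\<in>{1, 2, 3}. e i (st i)) \<le> 3 - (\<alpha> + \<beta> + \<gamma> + 2 * \<delta> + \<omega>)"
    using total nonneg single[of 1 m1 "{0}"] single[of 2 m2 "{1}"] single[of 3 m3 "{2}"]
      pair[of 1 2 \<alpha> "{3}"] pair[of 1 3 \<beta> "{4}"] pair[of 2 3 \<gamma> "{5}"] triple[of \<delta> "{6}"]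
      pair[of 1 2 \<omega> "{8, 9}"] pair[of 1 3 \<omega> "{7, 10}"]
    by (simp del: One_nat_def add: affine_st[OF aff(1)] affine_st[OF aff(2)] affine_st[OF aff(3)] model_vertices_def)
qed

lemma in_gpt_profile_region3:
  "(\<alpha> + \<delta>, \<beta> + \<delta>, \<gamma> + \<delta>, \<alpha> + \<beta> + \<gamma> + 2 * \<delta> + \<omega>) \<in> gpt_profile_region3"
proof -
  have "error_profile model_space st {1, 2} = \<alpha> + \<delta>" "error_profile model_space st {1, 3} = \<beta> + \<delta>"
    "error_profile model_space st {2, 3} = \<gamma> + \<delta>"
    "error_profile model_space st {1, 2, 3} = \<alpha> + \<beta> + \<gamma> + 2 * \<delta> + \<omega>"
    unfolding error_profile_def gpt_D_st_12 gpt_D_st_13 gpt_D_st_23 gpt_D_st_123 by simp_all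
  then show ?thesis
    unfolding gpt_profile_region3_def using gpt_state_space_model_space st_in
    by (intro CollectI exI[of _ 11] exI[of _ model_space] exI[of _ st]) auto
qed

end

section \<open>Facets and vertices of the polytope\<close>

lemma facet_of_irredundant_halfspaces:
  fixes a :: "'i \<Rightarrow> 'a::euclidean_space"
  assumes I: "finite I" and S: "S = {x. \<forall>i\<in>I. a i \<bullet> x \<le> b i}" and int: "interior S \<noteq> {}"
    and irr: "\<And>i. i \<in> I \<Longrightarrow> {x. \<forall>j\<in>I - {i}. a j \<bullet> x \<le> b j} \<noteq> S" and i: "i \<in> I"
  shows "{x \<in> S. a i \<bullet> x = b i} facet_of S"
proof -
  define h where "h j = {x. a j \<bullet> x \<le> b j}" for j
  have witness: "\<exists>x. (\<forall>k\<in>I - {j}. x \<in> h k) \<and> x \<notin> h j" if "j \<in> I" for j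
    using irr[OF that] unfolding S h_def by blast
  \<comment> \<open>\<open>facet_of_polyhedron_explicit\<close> speaks of a set of halfspaces
    instead of an indexed family. Irredundancy makes the family injective, so \<open>idx\<close> can
    recover the index from the halfspace.\<close>
  have inj: "inj_on h I"
    using witness by (intro inj_onI) (metis DiffI empty_iff insert_iff)
  have aff: "affine hull S = UNIV"
    by (rule affine_hull_nonempty_interior[OF int])
  define idx where "idx = inv_into I h"
  have idx: "idx (h j) = j" if "j \<in> I" for j
    using inj that by (simp add: idx_def)
  have S_eq: "S = affine hull S \<inter> \<Inter> (h ` I)"
    unfolding aff by (auto simp: S h_def)
  have halfspace: "a (idx k) \<noteq> 0 \<and> k = {x. a (idx k) \<bullet> x \<le> b (idx k)}" if "k \<in> h ` I" for k
  proof -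
    obtain j where j: "j \<in> I" "k = h j"
      using \<open>k \<in> h ` I\<close> by (elim imageE)
    obtain x where "x \<notin> h j"
      using witness[OF j(1)] by blast
    moreover obtain y where "y \<in> S"
      using int interior_subset by blast
    then have "y \<in> h j"
      using j(1) by (auto simp: S h_def)
    \<comment> \<open>With a zero normal the halfspace would be empty or the whole space, but it
      contains \<open>y\<close> and misses \<open>x\<close>.\<close>
    ultimately have "a j \<noteq> 0"
      by (auto simp: h_def)
    then show ?thesis
      using j by (simp add: idx) (simp add: h_def)
  qed
  have "S \<subset> affine hull S \<inter> \<Inter> F" if "F \<subset> h ` I" for F
  proof -
    obtain j where j: "j \<in> I" "h j \<notin> F"
      using \<open>F \<subset> h ` I\<close> by blast
    then obtain x where x: "\<forall>k\<in>I - {j}. x \<in> h k" "x \<notin> h j"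
      using witness by blast
    then have "x \<in> \<Inter> F" "x \<notin> S"
      using that j S_eq by auto
    moreover have "S \<subseteq> \<Inter> F"
      using that S_eq by blast
    ultimately show ?thesis
      unfolding aff by blast
  qed
  from facet_of_polyhedron_explicit[OF _ S_eq halfspace this, of "{x \<in> S. a i \<bullet> x = b i}"]
  show ?thesis
    using I i idx[OF i] by (force simp: Int_def)
qed

text \<open>A unique minimiser of a linear functional is exposed: the supporting hyperplane cuts out
  a face consisting of that point alone.\<close>

lemma extreme_point_of_supporting:
  fixes v :: "'a::real_inner"
  assumes "convex S" "v \<in> S" and sup: "\<And>p. p \<in> S \<Longrightarrow> c \<bullet> v \<le> c \<bullet> p"
    and uniq: "\<And>p. p \<in> S \<Longrightarrow> c \<bullet> p = c \<bullet> v \<Longrightarrow> p = v"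
  shows "v extreme_point_of S"
proof -
  have "S \<inter> {p. c \<bullet> p = c \<bullet> v} = {v}"
    using assms(2) uniq by auto
  with face_of_Int_supporting_hyperplane_ge[OF assms(1) sup] show ?thesis
    by (simp add: face_of_singleton)
qed

text \<open>The inequalities are numbered as in the final theorem, but written as upper bounds on
  inner products, hence the reversed signs.\<close>

definition profile_normal :: "nat \<Rightarrow> real \<times> real \<times> real \<times> real" where
  "profile_normal i =
     [(-1, 0, 0, 0), (0, -1, 0, 0), (0, 0, -1, 0), (1, 1, 0, -1), (1, 0, 1, -1), (0, 1, 1, -1),
      (-1, 0, 0, 1), (0, -1, 0, 1), (0, 0, -1, 1)] ! i"

definition profile_bound :: "nat \<Rightarrow> real" where
  "profile_bound i = (if i < 6 then 0 else 1)"

lemma All_less_9: "(\<forall>i<9. P i) \<longleftrightarrow> P 0 \<and> P 1 \<and> P 2 \<and> P 3 \<and> P 4 \<and> P 5 \<and> P 6 \<and> P 7 \<and> P (8 :: nat)"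
  by (simp add: numeral_eq_Suc All_less_Suc conj_ac)

lemma profile_polytope_eq: "profile_polytope = {p. \<forall>i\<in>{..<9}. profile_normal i \<bullet> p \<le> profile_bound i}"
  by (auto simp: profile_polytope_def profile_normal_def profile_bound_def Ball_def All_less_9)

lemma profile_polytope_irredundant:
  assumes "i < 9"
  shows "{p. \<forall>j\<in>{..<9} - {i}. profile_normal j \<bullet> p \<le> profile_bound j} \<noteq> profile_polytope"
proof -
  \<comment> \<open>facet centroids (the mean of the vertices on the facet), pushed slightly outwards\<close>
  define w :: "nat \<Rightarrow> real \<times> real \<times> real \<times> real" where
    "w k = [(-1/10, 1/4, 1/4, 3/4), (1/4, -1/10, 1/4, 3/4), (1/4, 1/4, -1/10, 3/4),
      (1/2, 1/2, 1/4, 9/10), (1/2, 1/4, 1/2, 9/10), (1/4, 1/2, 1/2, 9/10),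
      (1/4, 1/2, 1/2, 13/10), (1/2, 1/4, 1/2, 13/10), (1/2, 1/2, 1/4, 13/10)] ! k" for k
  have "\<forall>k<9. (\<forall>j<9. j \<noteq> k \<longrightarrow> profile_normal j \<bullet> w k \<le> profile_bound j) \<and>
      \<not> profile_normal k \<bullet> w k \<le> profile_bound k"
    by (simp add: All_less_9 w_def profile_normal_def profile_bound_def)
  then show ?thesis
    using assms unfolding profile_polytope_eq by blast
qed

lemma interior_profile_polytope: "interior profile_polytope \<noteq> {}"
proof -
  define U where "U = {p. \<forall>i\<in>{..<9}. profile_normal i \<bullet> p < profile_bound i}"
  have "U = (\<Inter>i\<in>{..<9}. {p. profile_normal i \<bullet> p < profile_bound i})"
    by (auto simp: U_def)
  then have "open U"
    by (simp only:) (intro open_INT finite_lessThan ballI open_halfspace_lt)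
  moreover have "U \<subseteq> profile_polytope"
    unfolding U_def profile_polytope_eq by (auto intro: less_imp_le)
  moreover have "(1/4, 1/4, 1/4, 3/4) \<in> U"
    by (simp add: U_def Ball_def All_less_9 profile_normal_def profile_bound_def)
  ultimately show ?thesis
    using interior_maximal by blast
qed

lemma convex_profile_polytope: "convex profile_polytope"
proof -
  have "profile_polytope = (\<Inter>i\<in>{..<9}. {p. profile_normal i \<bullet> p \<le> profile_bound i})"
    by (auto simp: profile_polytope_eq)
  moreover have "convex (\<Inter>i\<in>{..<9}. {p. profile_normal i \<bullet> p \<le> profile_bound i})"
    by (intro convex_INT convex_halfspace_le)
  ultimately show ?thesis
    by simp
qed

text \<open>Once \<delta> is chosen, the equations determine the other weights, and the weights sum
  to t - \<delta>. Nonnegativity and total at most 1 say that \<delta> lies above 0, x + y + z - t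
  and t - 1 and below x, y and z. Comparing three lower with three upper bounds gives exactly the
  nine inequalities.\<close>

lemma profile_polytope_weights:
  assumes "(x, y, z, t) \<in> profile_polytope"
  obtains \<alpha> \<beta> \<gamma> \<delta> \<omega> where "0 \<le> \<alpha>" "0 \<le> \<beta>" "0 \<le> \<gamma>" "0 \<le> \<delta>" "0 \<le> \<omega>"
    "\<alpha> + \<beta> + \<gamma> + \<delta> + \<omega> \<le> 1"
    "x = \<alpha> + \<delta>" "y = \<beta> + \<delta>" "z = \<gamma> + \<delta>" "t = \<alpha> + \<beta> + \<gamma> + 2 * \<delta> + \<omega>"
proof
  \<comment> \<open>any \<open>\<delta>\<close> between this lower bound and \<open>min x (min y z)\<close> works\<close>
  define \<delta> where "\<delta> = max 0 (max (x + y + z - t) (t - 1))"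
  show "0 \<le> x - \<delta>" "0 \<le> y - \<delta>" "0 \<le> z - \<delta>" "0 \<le> \<delta>" "0 \<le> t - (x + y + z) + \<delta>"
    "(x - \<delta>) + (y - \<delta>) + (z - \<delta>) + \<delta> + (t - (x + y + z) + \<delta>) \<le> 1"
    using assms by (auto simp: profile_polytope_def \<delta>_def)
qed auto

definition profile_vertices :: "(real \<times> real \<times> real \<times> real) set" where
  "profile_vertices =
     {(0, 0, 0, 0), (1, 0, 0, 1), (0, 1, 0, 1), (0, 0, 1, 1), (1, 1, 1, 2), (0, 0, 0, 1)}"

text \<open>The weights of the model states double as barycentric coordinates with respect to the
  six vertices, the remaining mass going to the origin.\<close>

lemma profile_polytope_subset_hull: "profile_polytope \<subseteq> convex hull profile_vertices"
proof (clarify)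
  fix x y z t assume "(x, y, z, t) \<in> profile_polytope"
  then obtain \<alpha> \<beta> \<gamma> \<delta> \<omega> where w: "0 \<le> \<alpha>" "0 \<le> \<beta>" "0 \<le> \<gamma>" "0 \<le> \<delta>" "0 \<le> \<omega>"
      "\<alpha> + \<beta> + \<gamma> + \<delta> + \<omega> \<le> 1"
    and xyzt: "x = \<alpha> + \<delta>" "y = \<beta> + \<delta>" "z = \<gamma> + \<delta>" "t = \<alpha> + \<beta> + \<gamma> + 2 * \<delta> + \<omega>"
    by (rule profile_polytope_weights)
  define u where "u = (\<lambda>i. [1 - (\<alpha> + \<beta> + \<gamma> + \<delta> + \<omega>), \<alpha>, \<beta>, \<gamma>, \<delta>, \<omega>] ! i)"
  define v :: "nat \<Rightarrow> real \<times> real \<times> real \<times> real" where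
    "v = (\<lambda>i. [(0, 0, 0, 0), (1, 0, 0, 1), (0, 1, 0, 1), (0, 0, 1, 1), (1, 1, 1, 2), (0, 0, 0, 1)] ! i)"
  have 6: "{..<6} = {0, 1, 2, 3, 4, 5 :: nat}"
    by auto
  have "(\<Sum>i<6. u i *\<^sub>R v i) \<in> convex hull profile_vertices"
    by (rule convex_sum) (use w in \<open>auto simp: 6 u_def v_def profile_vertices_def hull_inc\<close>)
  also have "(\<Sum>i<6. u i *\<^sub>R v i) = (x, y, z, t)"
    by (simp add: 6 u_def v_def xyzt)
  finally show "(x, y, z, t) \<in> convex hull profile_vertices" .
qed

lemma extreme_points_profile_polytope: "{v. v extreme_point_of profile_polytope} = profile_vertices"
proof
  have "profile_vertices \<subseteq> profile_polytope"
    by (auto simp: profile_vertices_def profile_polytope_def)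
  then have hull: "profile_polytope = convex hull profile_vertices"
    using profile_polytope_subset_hull convex_profile_polytope by (simp add: hull_minimal subset_antisym)
  show "{v. v extreme_point_of profile_polytope} \<subseteq> profile_vertices"
    unfolding hull using extreme_point_of_convex_hull by blast
  \<comment> \<open>\<open>c\<close> is a supporting functional minimised at \<open>v\<close> only: a positive combination of the inequalities tight at \<open>v\<close>\<close>
  have "v extreme_point_of profile_polytope"
    if "(v, c) \<in> {((0, 0, 0, 0), (0, 0, 0, 1)), ((1, 0, 0, 1), (-2, 1, 1, 0)), ((0, 1, 0, 1), (1, -2, 1, 0)),
      ((0, 0, 1, 1), (1, 1, -2, 0)), ((1, 1, 1, 2), (-1, -1, -1, 0)), ((0, 0, 0, 1), (2, 2, 2, -3))}"
    for v c :: "real \<times> real \<times> real \<times> real"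
    using that
    by (intro extreme_point_of_supporting[OF convex_profile_polytope, of v c]) (auto simp: profile_polytope_def)
  then show "profile_vertices \<subseteq> {v. v extreme_point_of profile_polytope}"
    unfolding profile_vertices_def by blast
qed

section \<open>The region is the polytope\<close>

lemma gpt_profile_region3_eq: "gpt_profile_region3 = profile_polytope"
proof
  show "profile_polytope \<subseteq> gpt_profile_region3"
  proof (clarify)
    fix x y z t assume p: "(x, y, z, t) \<in> profile_polytope"
    then obtain \<alpha> \<beta> \<gamma> \<delta> \<omega> where w: "0 \<le> \<alpha>" "0 \<le> \<beta>" "0 \<le> \<gamma>" "0 \<le> \<delta>" "0 \<le> \<omega>"
        "\<alpha> + \<beta> + \<gamma> + \<delta> + \<omega> \<le> 1"
      and xyzt: "x = \<alpha> + \<delta>" "y = \<beta> + \<delta>" "z = \<gamma> + \<delta>" "t = \<alpha> + \<beta> + \<gamma> + 2 * \<delta> + \<omega>"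
      by (rule profile_polytope_weights)
    \<comment> \<open>The private masses fill each state up to total mass 1; they are nonnegative
      since all five weights together sum to at most 1.\<close>
    interpret profile_weights \<alpha> \<beta> \<gamma> \<delta> \<omega> "1 - (\<alpha> + \<beta> + \<delta> + \<omega>)" "1 - (\<alpha> + \<gamma> + \<delta> + \<omega>)" "1 - (\<beta> + \<gamma> + \<delta> + \<omega>)"
      using w by unfold_locales auto
    show "(x, y, z, t) \<in> gpt_profile_region3"
      unfolding xyzt by (rule in_gpt_profile_region3)
  qed
qed (rule gpt_profile_region3_subset)

theorem theorem5p1:
  shows
    "(let g :: (real \<times> real \<times> real \<times> real \<Rightarrow> real) list =
          [\<lambda>(x, y, z, t). x, \<lambda>(x, y, z, t). y, \<lambda>(x, y, z, t). z,
           \<lambda>(x, y, z, t). t - (x + y), \<lambda>(x, y, z, t). t - (x + z), \<lambda>(x, y, z, t). t - (y + z),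
           \<lambda>(x, y, z, t). 1 + x - t, \<lambda>(x, y, z, t). 1 + y - t, \<lambda>(x, y, z, t). 1 + z - t]
     in gpt_profile_region3 = {p. \<forall>i<9. 0 \<le> (g ! i) p} \<and>
        (\<forall>i<9. {p \<in> gpt_profile_region3. (g ! i) p = 0} facet_of gpt_profile_region3) \<and>
        (\<forall>i<9. {p. \<forall>j<9. j \<noteq> i \<longrightarrow> 0 \<le> (g ! j) p} \<noteq> gpt_profile_region3)) \<and>
     {v. v extreme_point_of gpt_profile_region3} =
       {(0, 0, 0, 0), (1, 0, 0, 1), (0, 1, 0, 1), (0, 0, 1, 1), (1, 1, 1, 2), (0, 0, 0, 1)}"
proof -
  define g :: "(real \<times> real \<times> real \<times> real \<Rightarrow> real) list" where "g =
    [\<lambda>(x, y, z, t). x, \<lambda>(x, y, z, t). y, \<lambda>(x, y, z, t). z,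
     \<lambda>(x, y, z, t). t - (x + y), \<lambda>(x, y, z, t). t - (x + z), \<lambda>(x, y, z, t). t - (y + z),
     \<lambda>(x, y, z, t). 1 + x - t, \<lambda>(x, y, z, t). 1 + y - t, \<lambda>(x, y, z, t). 1 + z - t]"
  \<comment> \<open>Each \<open>g ! i\<close> is the slack in the corresponding halfspace, so its
    zero set is the bounding hyperplane.\<close>
  have "\<forall>i<9. \<forall>p. (g ! i) p = profile_bound i - profile_normal i \<bullet> p"
    unfolding All_less_9 by (simp add: g_def profile_bound_def profile_normal_def)
  then have g: "(g ! i) p = profile_bound i - profile_normal i \<bullet> p" if "i < 9" for i p
    using that by blast
  have "profile_polytope = {p. \<forall>i<9. 0 \<le> (g ! i) p}"
    by (auto simp: profile_polytope_eq g)
  moreover have "{p \<in> profile_polytope. (g ! i) p = 0} facet_of profile_polytope" if "i < 9" for i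
  proof -
    have "{p \<in> profile_polytope. (g ! i) p = 0} =
        {p \<in> profile_polytope. profile_normal i \<bullet> p = profile_bound i}"
      using that by (auto simp: g)
    then show ?thesis
      using facet_of_irredundant_halfspaces[OF _ profile_polytope_eq interior_profile_polytope
          profile_polytope_irredundant, of i] that by simp
  qed
  moreover have "{p. \<forall>j<9. j \<noteq> i \<longrightarrow> 0 \<le> (g ! j) p} \<noteq> profile_polytope" if "i < 9" for i
  proof -
    have "{p. \<forall>j<9. j \<noteq> i \<longrightarrow> 0 \<le> (g ! j) p} =
        {p. \<forall>j\<in>{..<9} - {i}. profile_normal j \<bullet> p \<le> profile_bound j}"
      by (auto simp: g)
    then show ?thesis
      using profile_polytope_irredundant[OF that] by simp
  qed
  ultimately show ?thesis
    unfolding gpt_profile_region3_eq Let_def g_def[symmetric] profile_vertices_def[symmetric]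
    using extreme_points_profile_polytope by blast
qed

end
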